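(* Let $n\ge 2$ and $d\ge n+1$. For every Perazzo form $f$ of degree $d$ in $S$, the $h$-vector $(h_0,\dots,h_d)$ of $A_f$ is unimodal, i.e. there is $j$ with $h_0\le h_1\le\cdots\le h_j\ge h_{j+1}\ge\cdots\ge h_d$.
   Context: $K$ is an algebraically closed field of characteristic zero. $S=K[x_0,\dots,x_n,u,v]$ and $R=K[y_0,\dots,y_n,U,V]$ acts on $S$ by differentiation ($y_i=\partial/\partial x_i$, $U=\partial/\partial u$, $V=\partial/\partial v$); write $\theta\circ f$ for this action. A Perazzo form of degree $d$ is $f=x_0p_0+x_1p_1+\cdots+x_np_n+g$ where $p_0,\dots,p_n\in K[u,v]_{d-1}$ are linearly independent but algebraically dependent forms and $g\in K[u,v]_d$. $\operatorname{Ann}_R(f)=\{\theta\in R:\theta\circ f=0\}$ and $A_f=R/\operatorname{Ann}_R(f)$ is a graded artinian Gorenstein algebra of socle degree $d$; its $h$-vector is $h_i=\dim_K [A_f]_i$, which equals the dimension of the $K$-span of all order-$i$ partial derivatives of $f$, and satisfies $h_i=h_{d-i}$. *)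

theory Defs
  imports Main "HOL-Library.Poly_Mapping" "HOL-Computational_Algebra.Polynomial"
begin

text \<open>Multivariate polynomials over a field, in variables indexed by natural numbers:
  a polynomial is a finitely supported map from exponent vectors (finitely supported
  maps nat to nat) to coefficients; multiplication is the convolution product of
  Poly_Mapping. In S = K[x_0,...,x_n,u,v] we use index i for x_i (i \<le> n),
  index n+1 for u and index n+2 for v.\<close>

type_synonym 'a mpoly = "(nat \<Rightarrow>\<^sub>0 nat) \<Rightarrow>\<^sub>0 'a"

definition algebraically_closed_type :: "'a::field itself \<Rightarrow> bool" where
  "algebraically_closed_type _ \<longleftrightarrow>
     (\<forall>p :: 'a poly. degree p > 0 \<longrightarrow> (\<exists>x. poly p x = 0))"

definition mvar :: "nat \<Rightarrow> 'a::comm_ring_1 mpoly" where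
  "mvar i = Poly_Mapping.single (Poly_Mapping.single i 1) 1"

definition mconst :: "'a::comm_ring_1 \<Rightarrow> 'a mpoly" where
  "mconst c = Poly_Mapping.single 0 c"

definition mscale :: "'a::comm_ring_1 \<Rightarrow> 'a mpoly \<Rightarrow> 'a mpoly" where
  "mscale c p = mconst c * p"

definition mdeg :: "(nat \<Rightarrow>\<^sub>0 nat) \<Rightarrow> nat" where
  "mdeg m = (\<Sum>i\<in>Poly_Mapping.keys m. Poly_Mapping.lookup m i)"

definition is_form_in :: "nat set \<Rightarrow> nat \<Rightarrow> 'a::comm_ring_1 mpoly \<Rightarrow> bool" where
  "is_form_in V k p \<longleftrightarrow> (\<forall>m\<in>Poly_Mapping.keys p. Poly_Mapping.keys m \<subseteq> V \<and> mdeg m = k)"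

definition mpderiv :: "nat \<Rightarrow> 'a::comm_ring_1 mpoly \<Rightarrow> 'a mpoly" where
  "mpderiv i p = (\<Sum>m\<in>Poly_Mapping.keys p.
      Poly_Mapping.single (m - Poly_Mapping.single i 1) (Poly_Mapping.lookup p m * of_nat (Poly_Mapping.lookup m i)))"

definition msubst :: "(nat \<Rightarrow> 'a::comm_ring_1 mpoly) \<Rightarrow> 'a mpoly \<Rightarrow> 'a mpoly" where
  "msubst q F = (\<Sum>m\<in>Poly_Mapping.keys F. mconst (Poly_Mapping.lookup F m) * (\<Prod>i\<in>Poly_Mapping.keys m. q i ^ Poly_Mapping.lookup m i))"

definition perazzo_form :: "nat \<Rightarrow> nat \<Rightarrow> 'a::field mpoly \<Rightarrow> bool" where
  "perazzo_form n d f \<longleftrightarrow>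
     (\<exists>(p :: nat \<Rightarrow> 'a mpoly) g.
        (\<forall>i\<le>n. is_form_in {n+1, n+2} (d - 1) (p i)) \<and>
        is_form_in {n+1, n+2} d g \<and>
        (\<forall>c :: nat \<Rightarrow> 'a. (\<Sum>i\<le>n. mscale (c i) (p i)) = 0 \<longrightarrow> (\<forall>i\<le>n. c i = 0)) \<and>
        (\<exists>F :: 'a mpoly. F \<noteq> 0 \<and> (\<forall>m\<in>Poly_Mapping.keys F. Poly_Mapping.keys m \<subseteq> {..n}) \<and> msubst p F = 0) \<and>
        f = (\<Sum>i\<le>n. mvar i * p i) + g)"

definition partials_of_order :: "nat \<Rightarrow> nat \<Rightarrow> 'a::comm_ring_1 mpoly \<Rightarrow> 'a mpoly set" where
  "partials_of_order n k f =
     {foldr mpderiv js f | js. length js = k \<and> set js \<subseteq> {..n+2}}"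

text \<open>h-vector of A_f: h_k = dim_K [A_f]_k = dimension of the K-span of the order-k
  partial derivatives of f.\<close>
definition hvec :: "nat \<Rightarrow> 'a::field mpoly \<Rightarrow> nat \<Rightarrow> nat" where
  "hvec n f k = vector_space.dim mscale (partials_of_order n k f)"

definition unimodal_upto :: "nat \<Rightarrow> (nat \<Rightarrow> nat) \<Rightarrow> bool" where
  "unimodal_upto d h \<longleftrightarrow>
     (\<exists>j\<le>d. (\<forall>i<j. h i \<le> h (i+1)) \<and> (\<forall>i. j \<le> i \<and> i < d \<longrightarrow> h (i+1) \<le> h i))"

end

theory Submission
  imports Defs "HOL-Analysis.Product_Vector"
begin

text \<open>Let \<open>W\<^sub>k\<close> be the span of the order-\<open>k\<close> partial derivatives of \<open>f\<close>. Since \<open>f\<close> has degree at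
  most 1 in the \<open>x\<^sub>i\<close>, any product of two \<open>y\<^sub>i\<close> kills \<open>f\<close>, so for \<open>k \<ge> 1\<close> the map
  \<open>(a, b) \<mapsto> U a + V b\<close> sends \<open>W\<^sub>k \<times> W\<^sub>k\<close> onto \<open>W\<^sub>k\<^sub>+\<^sub>1\<close>. Its kernel contains all \<open>(V c, - U c)\<close> with
  \<open>c \<in> W\<^sub>k\<^sub>-\<^sub>1\<close>, and \<open>c \<mapsto> (V c, - U c)\<close> is injective on \<open>W\<^sub>k\<^sub>-\<^sub>1\<close> as long as \<open>d - (k - 1) \<ge> 2\<close>, because a
  form of degree at least 2 that is killed by \<open>U\<close> and \<open>V\<close> would have degree at least 2 in the \<open>x\<^sub>i\<close>.
  Hence \<open>h\<^sub>k\<^sub>-\<^sub>1 + h\<^sub>k\<^sub>+\<^sub>1 \<le> 2 h\<^sub>k\<close> for \<open>1 \<le> k < d\<close>: the \<open>h\<close>-vector is even concave.\<close>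

section \<open>Concave sequences\<close>

text \<open>By concavity the increments of \<open>h\<close> never grow, so after the first strict
  descent every later step descends too. The peak is put at that first descent.\<close>

lemma unimodal_upto_if_concave:
  assumes concave: "\<And>k. Suc k < d \<Longrightarrow> h k + h (Suc (Suc k)) \<le> 2 * h (Suc k)"
  shows "unimodal_upto d h"
proof -
  \<comment> \<open>The alternative \<open>j = d\<close> covers sequences without a descent before
    \<open>d\<close> and bounds the peak by \<open>d\<close>.\<close>
  define j where "j = (LEAST j. j = d \<or> h (Suc j) < h j)"
  have j: "j = d \<or> h (Suc j) < h j"
    unfolding j_def by (rule LeastI[of _ d]) simp
  have "j \<le> d"
    unfolding j_def by (rule Least_le) simp
  have up: "h i \<le> h (i + 1)" if "i < j" for i
    using not_less_Least[OF that[unfolded j_def]] by simp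
  have "i < d \<longrightarrow> h (Suc i) < h i" if "j \<le> i" for i
    using that
  proof (induction i rule: dec_induct)
    case base
    then show ?case using j by auto
  next
    case (step i)
    then show ?case using concave[of i] by auto
  qed
  then show ?thesis
    unfolding unimodal_upto_def using \<open>j \<le> d\<close> up by (intro exI[of _ j]) (auto intro: less_imp_le)
qed

section \<open>Dimension counts for spans of sets\<close>

text \<open>A set of infinite rank has \<open>dim\<close> 0, since infinite sets have
  \<open>card\<close> 0. The finite set \<open>X\<close> forces the basis of \<open>T\<close> to be
  finite.\<close>

lemma (in vector_space) dim_mono_finite_span:
  assumes "S \<subseteq> span T" "T \<subseteq> span X" "finite X"
  shows "dim S \<le> dim T"
proof -
  obtain B where B: "B \<subseteq> T" "independent B" "T \<subseteq> span B" "card B = dim T"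
    using basis_exists by blast
  have "finite B"
    using independent_span_bound[OF \<open>finite X\<close> B(2)] B(1) assms(2) by blast
  moreover have "S \<subseteq> span B"
    using assms(1) B(3) span_minimal[OF B(3) subspace_span] by blast
  ultimately show ?thesis
    using dim_le_card B(4) by metis
qed

text \<open>One half of rank-nullity, for sets that need not be subspaces: extend a basis
  \<open>B\<close> of \<open>K\<close> to a basis \<open>C\<close> of \<open>S\<close>; the vectors
  of \<open>B\<close> map to 0, so the images of \<open>C - B\<close> span the image.\<close>

lemma (in vector_space_pair) dim_kernel_plus_dim_image_le:
  assumes f: "Vector_Spaces.linear s1 s2 f" and "K \<subseteq> S" and S: "S \<subseteq> vs1.span X" "finite X"
    and ker: "\<And>x. x \<in> K \<Longrightarrow> f x = 0"
  shows "vs1.dim K + vs2.dim (f ` S) \<le> vs1.dim S"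
proof -
  interpret f: Vector_Spaces.linear s1 s2 f by (rule f)
  obtain B where B: "B \<subseteq> K" "vs1.independent B" "K \<subseteq> vs1.span B" "card B = vs1.dim K"
    using vs1.basis_exists by blast
  obtain C where C: "B \<subseteq> C" "C \<subseteq> S" "vs1.independent C" "S \<subseteq> vs1.span C"
    using vs1.maximal_independent_subset_extend[of B S] B \<open>K \<subseteq> S\<close> by blast
  have "finite C"
    using vs1.independent_span_bound[OF \<open>finite X\<close> C(3)] C(2) S(1) by blast
  have "f ` S \<subseteq> vs2.span (f ` C)"
    using C(4) f.span_image by blast
  also have "\<dots> \<subseteq> vs2.span (f ` (C - B))"
  proof (rule vs2.span_minimal[OF _ vs2.subspace_span], rule image_subsetI)
    fix x assume "x \<in> C"
    then show "f x \<in> vs2.span (f ` (C - B))"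
      using ker B(1) vs2.span_zero by (cases "x \<in> B") (auto intro: vs2.span_base)
  qed
  finally have "vs2.dim (f ` S) \<le> card (f ` (C - B))"
    using \<open>finite C\<close> by (intro vs2.dim_le_card) auto
  also have "\<dots> \<le> card C - card B"
    using \<open>finite C\<close> C(1) by (metis card_Diff_subset card_image_le finite_Diff finite_subset)
  finally show ?thesis
    using B(4) vs1.basis_card_eq_dim[OF C(2,4,3)] card_mono[OF \<open>finite C\<close> C(1)] by linarith
qed

lemma (in vector_space_pair) dim_le_dim_image_if_inj_on_span:
  assumes f: "Vector_Spaces.linear s1 s2 f" and inj: "\<And>x. x \<in> vs1.span A \<Longrightarrow> f x = 0 \<Longrightarrow> x = 0"
    and X: "f ` A \<subseteq> vs2.span X" "finite X"
  shows "vs1.dim A \<le> vs2.dim (f ` A)"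
proof -
  interpret f: Vector_Spaces.linear s1 s2 f by (rule f)
  obtain B where B: "B \<subseteq> A" "vs1.independent B" "A \<subseteq> vs1.span B" "card B = vs1.dim A"
    using vs1.basis_exists by blast
  have sub: "vs1.span B \<subseteq> vs1.span A"
    using B(1) vs1.span_mono by blast
  have inj_on: "inj_on f (vs1.span B)"
    using inj sub by (auto simp: f.inj_on_iff_eq_0 vs1.subspace_span)
  have "vs2.independent (f ` B)"
    using linear_independent_injective_image[OF f B(2) inj_on] .
  then have "card (f ` B) = vs2.dim (f ` B)"
    by (simp add: vs2.dim_eq_card_independent)
  also have "\<dots> \<le> vs2.dim (f ` A)"
    using B(1) X by (intro vs2.dim_mono_finite_span[of _ _ X]) (auto intro: vs2.span_base)
  also have "card (f ` B) = card B"
    using inj_on vs1.span_superset by (intro card_image) (meson inj_on_subset)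
  finally show ?thesis using B(4) by simp
qed

text \<open>Each pair splits as \<open>(a, 0) + (0, b)\<close>. The second claim provides the finite
  spanning set that the preceding dimension lemmas ask for.\<close>

lemma (in vector_space_prod) dim_Times_le:
  assumes A: "A \<subseteq> vs1.span X" "finite X" and B: "B \<subseteq> vs2.span Y" "finite Y"
  shows "p.dim (A \<times> B) \<le> card X + card Y"
    and "A \<times> B \<subseteq> p.span (X \<times> {0} \<union> {0} \<times> Y)"
proof -
  let ?Z = "X \<times> {0} \<union> {0} \<times> Y"
  have l: "(a, 0) \<in> p.span ?Z" if "a \<in> vs1.span X" for a
    using that
  proof (induction rule: vs1.span_induct_alt)
    case base
    then show ?case using p.span_zero by (simp add: zero_prod_def)
  next
    case (step c x y)
    have "(x, 0) \<in> p.span ?Z" using step by (intro p.span_base) auto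
    then have "scale c (x, 0) + (y, 0) \<in> p.span ?Z"
      using step by (intro p.span_add p.span_scale)
    then show ?case by (simp add: scale_prod)
  qed
  have r: "(0, b) \<in> p.span ?Z" if "b \<in> vs2.span Y" for b
    using that
  proof (induction rule: vs2.span_induct_alt)
    case base
    then show ?case using p.span_zero by (simp add: zero_prod_def)
  next
    case (step c x y)
    have "(0, x) \<in> p.span ?Z" using step by (intro p.span_base) auto
    then have "scale c (0, x) + (0, y) \<in> p.span ?Z"
      using step by (intro p.span_add p.span_scale)
    then show ?case by (simp add: scale_prod)
  qed
  show sub: "A \<times> B \<subseteq> p.span ?Z"
  proof clarify
    fix a b assume "a \<in> A" "b \<in> B"
    then have "(a, 0) + (0, b) \<in> p.span ?Z"
      using A B by (intro p.span_add l r) auto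
    then show "(a, b) \<in> p.span ?Z" by simp
  qed
  have "p.dim (A \<times> B) \<le> card ?Z"
    using A B by (intro p.dim_le_card[OF sub]) auto
  also have "\<dots> \<le> card X + card Y"
    by (rule card_Un_le[THEN order_trans]) (simp add: card_cartesian_product)
  finally show "p.dim (A \<times> B) \<le> card X + card Y" .
qed

text \<open>A Koszul-type complex: \<open>\<iota>\<close> maps \<open>A\<close> into
  \<open>span B \<times> span B\<close>, and \<open>\<sigma>\<close> maps this product onto a space
  containing \<open>C\<close>. Commutativity gives \<open>\<sigma> (\<iota> c) = 0\<close>, the
  joint kernel condition makes \<open>\<iota>\<close> injective, and the middle term has dimension
  at most \<open>2 * dim B\<close>.\<close>

lemma (in vector_space) dim_add_dim_le_if_commuting:
  assumes \<phi>: "Vector_Spaces.linear scale scale \<phi>" and \<psi>: "Vector_Spaces.linear scale scale \<psi>"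
    and comm: "\<And>x. \<phi> (\<psi> x) = \<psi> (\<phi> x)"
    and inj: "\<And>x. x \<in> span A \<Longrightarrow> \<phi> x = 0 \<Longrightarrow> \<psi> x = 0 \<Longrightarrow> x = 0"
    and B: "finite B" "\<phi> ` A \<subseteq> span B" "\<psi> ` A \<subseteq> span B"
    and C: "C \<subseteq> span (\<phi> ` B \<union> \<psi> ` B)"
  shows "dim A + dim C \<le> 2 * dim B"
proof -
  interpret vector_space_prod scale scale by unfold_locales
  interpret \<phi>: Vector_Spaces.linear scale scale \<phi> by (rule \<phi>)
  interpret \<psi>: Vector_Spaces.linear scale scale \<psi> by (rule \<psi>)
  interpret P: vector_space_pair scale "module_prod.scale scale scale" by unfold_locales
  interpret Q: vector_space_pair "module_prod.scale scale scale" scale by unfold_locales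
  define \<sigma> where "\<sigma> = (\<lambda>(x, y). \<phi> x + \<psi> y)"
  define \<iota> where "\<iota> = (\<lambda>c. (\<psi> c, - \<phi> c))"
  have \<sigma>: "Vector_Spaces.linear (module_prod.scale scale scale) scale \<sigma>"
    unfolding \<sigma>_def by unfold_locales
      (auto simp: scale_prod \<phi>.add \<psi>.add \<phi>.scale \<psi>.scale scale_right_distrib)
  have \<iota>: "Vector_Spaces.linear scale (module_prod.scale scale scale) \<iota>"
    unfolding \<iota>_def by unfold_locales
      (auto simp: scale_prod \<phi>.add \<psi>.add \<phi>.scale \<psi>.scale)
  \<comment> \<open>\<open>B\<close> may be linearly dependent; counting with a basis
    \<open>D\<close> turns the bound by cardinalities into one by \<open>dim B\<close>.\<close>
  obtain D where D: "D \<subseteq> B" "independent D" "B \<subseteq> span D" "card D = dim B"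
    using basis_exists by blast
  have "finite D" using D(1) B(1) finite_subset by blast
  have BD: "span B \<subseteq> span D" using D(3) by (simp add: span_minimal)
  note Times = dim_Times_le[OF BD \<open>finite D\<close> BD \<open>finite D\<close>]
  let ?Z = "D \<times> {0} \<union> {0} \<times> D"
  have "finite ?Z" using \<open>finite D\<close> by simp
  have \<iota>A: "\<iota> ` A \<subseteq> span B \<times> span B"
    using B by (auto simp: \<iota>_def intro: span_neg)
  have "dim A \<le> p.dim (\<iota> ` A)"
    using inj \<iota>A Times(2) \<open>finite ?Z\<close>
    by (intro P.dim_le_dim_image_if_inj_on_span[OF \<iota>, of _ ?Z]) (auto simp: \<iota>_def zero_prod_def)
  moreover have "dim C \<le> dim (\<sigma> ` (span B \<times> span B))"
  proof (rule dim_mono_finite_span)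
    \<comment> \<open>The preimages are \<open>(b, 0)\<close> and \<open>(0, b)\<close>.\<close>
    have "\<phi> b \<in> \<sigma> ` (span B \<times> span B)" "\<psi> b \<in> \<sigma> ` (span B \<times> span B)" if "b \<in> B" for b
      using that span_zero span_base[OF that]
      by (force simp: \<sigma>_def \<phi>.zero \<psi>.zero image_iff)+
    then show "C \<subseteq> span (\<sigma> ` (span B \<times> span B))"
      using C by (meson image_subsetI le_sup_iff order_trans span_mono)
    interpret \<sigma>: Vector_Spaces.linear "module_prod.scale scale scale" scale \<sigma> by (rule \<sigma>)
    show "\<sigma> ` (span B \<times> span B) \<subseteq> span (\<sigma> ` ?Z)"
      using Times(2) \<sigma>.span_image by blast
    show "finite (\<sigma> ` ?Z)" using \<open>finite ?Z\<close> by blast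
  qed
  moreover have "p.dim (\<iota> ` A) + dim (\<sigma> ` (span B \<times> span B)) \<le> p.dim (span B \<times> span B)"
    using comm by (intro Q.dim_kernel_plus_dim_image_le[OF \<sigma> \<iota>A Times(2) \<open>finite ?Z\<close>])
      (auto simp: \<sigma>_def \<iota>_def \<psi>.neg)
  ultimately show ?thesis
    using Times(1) D(4) by linarith
qed

section \<open>Coefficients of polynomials and of their derivatives\<close>

lemma lookup_mscale [simp]: "Poly_Mapping.lookup (mscale c p) m = c * Poly_Mapping.lookup p m"
  by (simp add: mscale_def mconst_def flip: mult_map_scale_conv_mult)
    (simp add: Poly_Mapping.map.rep_eq when_def)

interpretation mpoly: vector_space "mscale :: 'a::field \<Rightarrow> 'a mpoly \<Rightarrow> 'a mpoly"
  by unfold_locales (auto intro!: poly_mapping_eqI simp: lookup_add algebra_simps)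

lemma lookup_mpderiv:
  "Poly_Mapping.lookup (mpderiv i p) m =
     Poly_Mapping.lookup p (m + Poly_Mapping.single i 1) * of_nat (Poly_Mapping.lookup m i + 1)"
proof -
  let ?s = "Poly_Mapping.single i (1::nat)"
  let ?c = "\<lambda>m'. Poly_Mapping.lookup p m' * of_nat (Poly_Mapping.lookup m' i)"
  \<comment> \<open>Subtraction truncates, so a monomial without variable \<open>i\<close> is sent
    to itself; its factor \<open>of_nat 0\<close> removes it from the sum.\<close>
  have shift: "m' = m + ?s" if "m' - ?s = m" "Poly_Mapping.lookup m' i \<noteq> 0" for m'
    using that by (auto intro!: poly_mapping_eqI simp: lookup_add lookup_minus lookup_single when_def)
  have "Poly_Mapping.lookup (mpderiv i p) m = (\<Sum>m'\<in>Poly_Mapping.keys p. ?c m' when m' - ?s = m)"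
    by (simp add: mpderiv_def lookup_sum lookup_single)
  also have "\<dots> = (\<Sum>m'\<in>Poly_Mapping.keys p. if m' = m + ?s then ?c m' else 0)"
    by (intro sum.cong refl) (use shift in \<open>fastforce simp: when_def\<close>)
  also have "\<dots> = ?c (m + ?s)"
    by (simp add: sum.delta in_keys_iff)
  finally show ?thesis
    by (simp add: lookup_add)
qed

lemma linear_mpderiv: "Vector_Spaces.linear mscale mscale (mpderiv i :: 'a::field mpoly \<Rightarrow> 'a mpoly)"
  by unfold_locales (auto intro!: poly_mapping_eqI simp: lookup_mpderiv lookup_add algebra_simps)

lemma mpderiv_zero [simp]: "mpderiv i 0 = 0"
  by (simp add: mpderiv_def)

lemma mpderiv_commute: "mpderiv i (mpderiv j p) = mpderiv j (mpderiv i p)"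
  by (cases "i = j")
    (auto intro!: poly_mapping_eqI simp: lookup_mpderiv lookup_add lookup_single ac_simps)

text \<open>Used to make a derivative by \<open>u\<close> or \<open>v\<close> the outermost
  one.\<close>

lemma foldr_mpderiv_pull:
  "foldr mpderiv (is @ j # js) f = mpderiv j (foldr mpderiv (is @ js) f)"
  by (induction "is") (auto simp: mpderiv_commute)

section \<open>Forms of degree at most one in the \<open>x_i\<close>\<close>

lemma mdeg_superset:
  assumes "finite V" "Poly_Mapping.keys m \<subseteq> V"
  shows "mdeg m = (\<Sum>i\<in>V. Poly_Mapping.lookup m i)"
  unfolding mdeg_def using assms by (intro sum.mono_neutral_left) (auto simp: in_keys_iff)

lemma keys_add_nat: "Poly_Mapping.keys (m + m' :: nat \<Rightarrow>\<^sub>0 nat) = Poly_Mapping.keys m \<union> Poly_Mapping.keys m'"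
  by (auto simp: in_keys_iff lookup_add)

lemma mdeg_add: "mdeg (m + m') = mdeg m + mdeg m'"
  using mdeg_superset[of "Poly_Mapping.keys (m + m')"]
  by (simp add: keys_add_nat lookup_add sum.distrib)

lemma mdeg_single [simp]: "mdeg (Poly_Mapping.single i k) = k"
  by (simp add: mdeg_def)

text \<open>The sum over \<open>i \<le> n\<close> is the joint degree in the \<open>x_i\<close>.
  Bounding it by 1 instead of fixing it gives a condition that holds for \<open>f\<close> and passes
  to all its derivatives.\<close>

definition linear_in_x :: "nat \<Rightarrow> nat \<Rightarrow> 'a::field mpoly set" where
  "linear_in_x n e = {p. \<forall>m\<in>Poly_Mapping.keys p.
     Poly_Mapping.keys m \<subseteq> {..n+2} \<and> mdeg m = e \<and> (\<Sum>i\<le>n. Poly_Mapping.lookup m i) \<le> 1}"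

lemma subspace_linear_in_x: "mpoly.subspace (linear_in_x n e :: 'a::field mpoly set)"
proof (rule mpoly.subspaceI)
  fix p q :: "'a mpoly"
  assume "p \<in> linear_in_x n e" "q \<in> linear_in_x n e"
  then show "p + q \<in> linear_in_x n e"
    using keys_add[of p q] unfolding linear_in_x_def by blast
qed (auto simp: linear_in_x_def in_keys_iff)

lemma mpderiv_linear_in_x:
  assumes "p \<in> linear_in_x n (Suc e)"
  shows "mpderiv i p \<in> linear_in_x n e"
  unfolding linear_in_x_def
proof (intro CollectI ballI)
  fix m assume "m \<in> Poly_Mapping.keys (mpderiv i p)"
  then have "m + Poly_Mapping.single i 1 \<in> Poly_Mapping.keys p"
    by (auto simp: in_keys_iff lookup_mpderiv)
  then have *: "Poly_Mapping.keys (m + Poly_Mapping.single i 1) \<subseteq> {..n+2}"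
      "mdeg (m + Poly_Mapping.single i 1) = Suc e"
      "(\<Sum>j\<le>n. Poly_Mapping.lookup (m + Poly_Mapping.single i 1) j) \<le> 1"
    using assms unfolding linear_in_x_def by blast+
  have "(\<Sum>j\<le>n. Poly_Mapping.lookup m j) \<le> 1"
    using *(3) by (simp add: lookup_add sum.distrib)
  then show "Poly_Mapping.keys m \<subseteq> {..n+2} \<and> mdeg m = e \<and> (\<Sum>i\<le>n. Poly_Mapping.lookup m i) \<le> 1"
    using *(1,2) by (simp add: keys_add_nat mdeg_add)
qed

lemma foldr_mpderiv_linear_in_x:
  assumes "f \<in> linear_in_x n (length js + e)"
  shows "foldr mpderiv js f \<in> linear_in_x n e"
  using assms by (induction js arbitrary: e) (auto intro: mpderiv_linear_in_x)

text \<open>If \<open>U\<close> and \<open>V\<close> kill \<open>p\<close>, no monomial of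
  \<open>p\<close> contains \<open>u\<close> or \<open>v\<close>, so its whole degree
  \<open>e \<ge> 2\<close> lies in the \<open>x_i\<close>, where at most 1 is allowed. For
  \<open>e = 1\<close> the form \<open>x_0\<close> is a counterexample.\<close>

lemma linear_in_x_eq_0:
  fixes p :: "'a::field_char_0 mpoly"
  assumes p: "p \<in> linear_in_x n e" and "e \<ge> 2"
    and U: "mpderiv (n+1) p = 0" and V: "mpderiv (n+2) p = 0"
  shows "p = 0"
proof (rule ccontr)
  assume "p \<noteq> 0"
  then obtain m where m: "m \<in> Poly_Mapping.keys p"
    using keys_eq_empty by blast
  have no_var: "Poly_Mapping.lookup m i = 0" if "mpderiv i p = 0" for i
  proof (rule ccontr)
    let ?s = "Poly_Mapping.single i (1::nat)"
    assume "Poly_Mapping.lookup m i \<noteq> 0"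
    then have "m - ?s + ?s = m"
      by (auto intro!: poly_mapping_eqI simp: lookup_add lookup_minus lookup_single when_def)
    \<comment> \<open>This coefficient is that of \<open>m\<close> times a positive exponent, which
      is nonzero in characteristic zero.\<close>
    then have "Poly_Mapping.lookup (mpderiv i p) (m - ?s) \<noteq> 0"
      using m by (simp add: lookup_mpderiv in_keys_iff of_nat_Suc[symmetric] del: of_nat_Suc)
    then show False using that by simp
  qed
  have "mdeg m = (\<Sum>i\<le>n+2. Poly_Mapping.lookup m i)"
    using p m by (intro mdeg_superset) (auto simp: linear_in_x_def)
  also have "\<dots> = (\<Sum>i\<le>n. Poly_Mapping.lookup m i)"
    using no_var[OF U] no_var[OF V] by simp
  finally show False
    using p m \<open>e \<ge> 2\<close> unfolding linear_in_x_def by force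
qed

text \<open>A surviving monomial would come from one of degree at least 2 in the \<open>x_i\<close>;
  the case \<open>i = j\<close> is included.\<close>

lemma mpderiv_mpderiv_eq_0:
  assumes p: "p \<in> linear_in_x n e" and "i \<le> n" "j \<le> n"
  shows "mpderiv i (mpderiv j p) = 0"
proof (rule poly_mapping_eqI)
  fix m :: "nat \<Rightarrow>\<^sub>0 nat"
  let ?m = "m + Poly_Mapping.single i 1 + Poly_Mapping.single j 1"
  have "(\<Sum>k\<le>n. Poly_Mapping.lookup ?m k) \<ge> 2"
    using assms(2,3) by (simp add: lookup_add sum.distrib lookup_single when_def sum.delta)
  then have "?m \<notin> Poly_Mapping.keys p"
    using p unfolding linear_in_x_def by force
  then have "Poly_Mapping.lookup p ?m = 0"
    by (simp add: in_keys_iff)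
  then show "Poly_Mapping.lookup (mpderiv i (mpderiv j p)) m = Poly_Mapping.lookup 0 m"
    by (simp add: lookup_mpderiv)
qed

text \<open>The summands \<open>x_i p_i\<close> have degree 1 in the \<open>x_i\<close>, and
  \<open>g\<close> has degree 0. Since \<open>d - 1\<close> truncates, \<open>d \<ge> 1\<close> is
  what makes the total degree \<open>d\<close>.\<close>

lemma perazzo_form_linear_in_x:
  assumes f: "perazzo_form n d f" and "d \<ge> 1"
  shows "f \<in> linear_in_x n d"
proof -
  obtain p g where p: "\<And>i. i \<le> n \<Longrightarrow> is_form_in {n+1, n+2} (d - 1) (p i)"
    and g: "is_form_in {n+1, n+2} d g" and f_eq: "f = (\<Sum>i\<le>n. mvar i * p i) + g"
    using f unfolding perazzo_form_def by blast
  have uv: "(\<Sum>i\<le>n. Poly_Mapping.lookup m i) = 0" if "Poly_Mapping.keys m \<subseteq> {n+1, n+2}"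
    for m :: "nat \<Rightarrow>\<^sub>0 nat"
    using that by (fastforce simp: in_keys_iff)
  have "g \<in> linear_in_x n d"
    using g uv unfolding linear_in_x_def is_form_in_def by fastforce
  moreover have "mvar i * p i \<in> linear_in_x n d" if "i \<le> n" for i
    unfolding linear_in_x_def
  proof (intro CollectI ballI)
    fix m assume "m \<in> Poly_Mapping.keys (mvar i * p i)"
    then obtain m' where m: "m = Poly_Mapping.single i 1 + m'" and "m' \<in> Poly_Mapping.keys (p i)"
      using keys_mult[of "mvar i" "p i"] by (auto simp: mvar_def)
    then have m': "Poly_Mapping.keys m' \<subseteq> {n+1, n+2}" "mdeg m' = d - 1"
      using p[OF that] unfolding is_form_in_def by blast+
    have "(\<Sum>k\<le>n. Poly_Mapping.lookup m k) \<le> 1"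
      using uv[OF m'(1)] by (simp add: m lookup_add sum.distrib lookup_single when_def sum.delta)
    moreover have "Poly_Mapping.keys m \<subseteq> {..n+2}"
      using m'(1) that by (auto simp: m keys_add_nat)
    ultimately show "Poly_Mapping.keys m \<subseteq> {..n+2} \<and> mdeg m = d \<and> (\<Sum>k\<le>n. Poly_Mapping.lookup m k) \<le> 1"
      using m'(2) \<open>d \<ge> 1\<close> by (simp add: m mdeg_add)
  qed
  ultimately show ?thesis
    unfolding f_eq
    by (intro mpoly.subspace_add[OF subspace_linear_in_x] mpoly.subspace_sum[OF subspace_linear_in_x]) auto
qed

section \<open>Spans of partial derivatives and concavity of the h-vector\<close>

lemma finite_partials_of_order: "finite (partials_of_order n k f)"
proof -
  have "partials_of_order n k f = (\<lambda>js. foldr mpderiv js f) ` {js. set js \<subseteq> {..n+2} \<and> length js = k}"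
    unfolding partials_of_order_def by auto
  then show ?thesis by (simp add: finite_lists_length_eq)
qed

lemma partials_of_order_linear_in_x:
  assumes "f \<in> linear_in_x n d" "k \<le> d"
  shows "partials_of_order n k f \<subseteq> linear_in_x n (d - k)"
  using assms unfolding partials_of_order_def by (auto intro!: foldr_mpderiv_linear_in_x)

lemma mpderiv_partials_of_order:
  assumes "p \<in> partials_of_order n k f" "i \<le> n + 2"
  shows "mpderiv i p \<in> partials_of_order n (Suc k) f"
proof -
  obtain js where "p = foldr mpderiv js f" "length js = k" "set js \<subseteq> {..n+2}"
    using assms(1) unfolding partials_of_order_def by blast
  then show ?thesis
    unfolding partials_of_order_def using assms(2) by (intro CollectI exI[of _ "i # js"]) auto
qed

text \<open>At least two derivatives are taken. If all are by some \<open>x_i\<close>, the two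
  outermost give 0; otherwise one by \<open>u\<close> or \<open>v\<close> is moved to the front and
  leaves a partial of order \<open>k + 1\<close>.\<close>

lemma partials_of_order_subset_span:
  assumes f: "f \<in> linear_in_x n d" and "k \<le> d"
  defines "B \<equiv> partials_of_order n (Suc k) f"
  shows "partials_of_order n (Suc (Suc k)) f \<subseteq> mpoly.span (mpderiv (n+1) ` B \<union> mpderiv (n+2) ` B)"
proof
  fix q assume "q \<in> partials_of_order n (Suc (Suc k)) f"
  then obtain js where q: "q = foldr mpderiv js f" and len: "length js = Suc (Suc k)"
    and js: "set js \<subseteq> {..n+2}"
    unfolding partials_of_order_def by blast
  show "q \<in> mpoly.span (mpderiv (n+1) ` B \<union> mpderiv (n+2) ` B)"
  proof (cases "set js \<subseteq> {..n}")
    case True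
    obtain i j "is" where eq: "js = i # j # is"
      using len by (metis length_Suc_conv)
    have "foldr mpderiv is f \<in> linear_in_x n (d - k)"
      using f len \<open>k \<le> d\<close> by (intro foldr_mpderiv_linear_in_x) (simp add: eq)
    then have "q = 0"
      using True mpderiv_mpderiv_eq_0 by (auto simp: q eq)
    then show ?thesis by (simp add: mpoly.span_zero)
  next
    case False
    then obtain j where j: "j \<in> set js" "j = n + 1 \<or> j = n + 2"
      using js by force
    then obtain xs ys where eq: "js = xs @ j # ys"
      by (meson split_list)
    have "foldr mpderiv (xs @ ys) f \<in> B"
      unfolding B_def partials_of_order_def using len js
      by (intro CollectI exI[of _ "xs @ ys"]) (auto simp: eq)
    then show ?thesis
      using j(2) by (intro mpoly.span_base) (auto simp only: q eq foldr_mpderiv_pull)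
  qed
qed

lemma hvec_concave:
  fixes f :: "'a::field_char_0 mpoly"
  assumes f: "f \<in> linear_in_x n d" and "Suc k < d"
  shows "hvec n f k + hvec n f (Suc (Suc k)) \<le> 2 * hvec n f (Suc k)"
  unfolding hvec_def
proof (rule mpoly.dim_add_dim_le_if_commuting[where \<phi> = "mpderiv (n+1)" and \<psi> = "mpderiv (n+2)"])
  show "p = 0" if "p \<in> mpoly.span (partials_of_order n k f)"
    "mpderiv (n+1) p = 0" "mpderiv (n+2) p = 0" for p
  proof (rule linear_in_x_eq_0[OF _ _ that(2,3)])
    show "p \<in> linear_in_x n (d - k)"
      using mpoly.span_minimal[OF partials_of_order_linear_in_x subspace_linear_in_x, OF f, of k]
        that(1) assms(2) by auto
    \<comment> \<open>The range \<open>Suc k < d\<close> is exactly the one in which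
      order-\<open>k\<close> partials have degree at least 2, as injectivity requires.\<close>
    show "d - k \<ge> 2" using assms(2) by simp
  qed
  show "mpderiv (n+1) ` partials_of_order n k f \<subseteq> mpoly.span (partials_of_order n (Suc k) f)"
    "mpderiv (n+2) ` partials_of_order n k f \<subseteq> mpoly.span (partials_of_order n (Suc k) f)"
    by (auto simp del: add_2_eq_Suc' intro!: mpoly.span_base mpderiv_partials_of_order)
qed (use partials_of_order_subset_span[OF f, of k] assms(2) in
  \<open>auto intro: linear_mpderiv mpderiv_commute finite_partials_of_order\<close>)

theorem theorem4p13:
  fixes f :: "'a::field_char_0 mpoly" and n d :: nat
  assumes "algebraically_closed_type TYPE('a)"
    and "n \<ge> 2" and "d \<ge> n + 1"
    and "perazzo_form n d f"
  shows "unimodal_upto d (hvec n f)"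
proof (rule unimodal_upto_if_concave)
  have "f \<in> linear_in_x n d"
    using assms(3,4) by (intro perazzo_form_linear_in_x) auto
  then show "hvec n f k + hvec n f (Suc (Suc k)) \<le> 2 * hvec n f (Suc k)" if "Suc k < d" for k
    using that by (rule hvec_concave)
qed

end
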